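(* Let $\mathbf f:\mathbb R^{2n}\to\mathbb R^{2n}$ be $$\mathbf f(\mathbf u,\mathbf v)=\begin{bmatrix}\mathbf u\\ \mathbf v\end{bmatrix}-\begin{bmatrix}\mathbf u\\ \mathbf v\end{bmatrix}\circ\begin{bmatrix}P\mathbf v\\ \tilde P\mathbf u\end{bmatrix}-\begin{bmatrix}\mathbf e\\ \mathbf e\end{bmatrix},$$ with $P,\tilde P$ determined by the parameters $c\in(0,1]$ and $\alpha\in[0,1)$ (see context). If $c(1+\alpha)\le\frac12$, then the sequence generated by the two-step Newton method for $\mathbf f$ starting from the zero vector converges Q-superquadratically to the minimal positive solution $\mathbf w_*=[\mathbf u_*^{\mathrm T},\mathbf v_*^{\mathrm T}]^{\mathrm T}$ of $\mathbf f(\mathbf u,\mathbf v)=\mathbf 0$. Moreover, the order of convergence is at least cubic (Q-cubic) if $c(1+\alpha)<\frac49$. In particular, $0<\|\mathbf w_*\|_\infty\le r$ whenever $$\frac{1-\sqrt{1-2c(1+\alpha)}}{c(1+\alpha)}\le r<\frac{1+\sqrt{1-2c(1+\alpha)}}{c(1+\alpha)}.$$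
   Context: $\circ$ is the Hadamard (entrywise) product, $\mathbf e$ the vector of ones, and norms are $\infty$-norms. Let $\{\omega_i\}_{i=1}^n$ and $\{c_i\}_{i=1}^n$ be the Gauss–Legendre nodes and weights on $[0,1]$, so that $0<\omega_n<\dots<\omega_2<\omega_1<1$, $c_i>0$, $\sum_{i=1}^nc_i=1$. Set $$\delta_i=\frac1{c\,\omega_i(1+\alpha)},\quad \gamma_i=\frac1{c\,\omega_i(1-\alpha)},\quad q_i=\frac{c_i}{2\omega_i},\quad P=\left(\frac{q_j}{\delta_i+\gamma_j}\right)_{n\times n},\quad \tilde P=\left(\frac{q_j}{\gamma_i+\delta_j}\right)_{n\times n}.$$ A positive solution is one all of whose components are positive; the minimal positive solution is the positive solution that is componentwise less than or equal to every positive solution. (It yields the minimal positive solution of the nonsymmetric algebraic Riccati equation $XCX-XD-AX+B=0$ with $A=\Delta-\mathbf e\mathbf q^{\mathrm T}$, $B=\mathbf e\mathbf e^{\mathrm T}$, $C=\mathbf q\mathbf q^{\mathrm T}$, $D=\Gamma-\mathbf q\mathbf e^{\mathrm T}$, $\Delta=\mathrm{diag}(\delta_i)$, $\Gamma=\mathrm{diag}(\gamma_i)$.) Two-step Newton method for $\mathbf f$: with $\mathbf w_0=\mathbf 0\in\mathbb R^{2n}$, $\mathbf z_k=\mathbf w_k-\mathbf f'(\mathbf w_k)^{-1}\mathbf f(\mathbf w_k)$, $\mathbf w_{k+1}=\mathbf z_k-\mathbf f'(\mathbf w_k)^{-1}\mathbf f(\mathbf z_k)$, $k=0,1,2,\dots$.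 $\{\mathbf w_k\}$ converges to $\mathbf w_*$ Q-superquadratically if for any $\epsilon>0$ there is $N$ with $\|\mathbf w_{k+1}-\mathbf w_*\|\le\epsilon\|\mathbf w_k-\mathbf w_*\|^2$ for all $k\ge N$; it converges Q-cubically if there are constants $C\ge0$, $N\ge0$ with $\|\mathbf w_{k+1}-\mathbf w_*\|\le C\|\mathbf w_k-\mathbf w_*\|^3$ for all $k\ge N$. *)

theory Defs
  imports "HOL-Analysis.Analysis" "HOL-Computational_Algebra.Polynomial"
begin

section \<open>Gauss--Legendre quadrature on $[0,1]$\<close>

text \<open>Rodrigues' formula for the Legendre polynomial transplanted to $[0,1]$:
  $\frac{1}{n!}\frac{d^n}{dx^n}(x^2-x)^n$.\<close>

definition shifted_legendre :: "nat \<Rightarrow> real poly" where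
  "shifted_legendre n = smult (1 / fact n) ((pderiv ^^ n) ([:0, -1, 1:] ^ n))"

definition lagrange_basis :: "real ^ 'n \<Rightarrow> 'n \<Rightarrow> real \<Rightarrow> real" where
  "lagrange_basis \<omega> i x = (\<Prod>j\<in>UNIV - {i}. (x - \<omega> $ j) / (\<omega> $ i - \<omega> $ j))"

text \<open>The number of nodes is \<open>CARD('n)\<close>. The nodes are distinct by the first conjunct, so they
  exhaust the roots of the Legendre polynomial; the weights are the interpolatory ones.\<close>

definition gauss_legendre ::
    "real ^ 'n::{finite,linorder} \<Rightarrow> real ^ 'n::{finite,linorder} \<Rightarrow> bool" where
  "gauss_legendre \<omega> wt \<longleftrightarrow>
     (\<forall>i j. i < j \<longrightarrow> \<omega> $ j < \<omega> $ i) \<and>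
     (\<forall>i. poly (shifted_legendre CARD('n)) (\<omega> $ i) = 0) \<and>
     (\<forall>i. wt $ i = integral {0..1} (lagrange_basis \<omega> i))"


section \<open>The vector equation\<close>

text \<open>The letter \<open>c\<close> is the scalar parameter; the quadrature weights $c_i$ are \<open>wt $ i\<close>.\<close>

definition delta :: "real ^ 'n \<Rightarrow> real \<Rightarrow> real \<Rightarrow> 'n \<Rightarrow> real" where
  "delta \<omega> c \<alpha> i = 1 / (c * \<omega> $ i * (1 + \<alpha>))"

definition gamma :: "real ^ 'n \<Rightarrow> real \<Rightarrow> real \<Rightarrow> 'n \<Rightarrow> real" where
  "gamma \<omega> c \<alpha> i = 1 / (c * \<omega> $ i * (1 - \<alpha>))"

definition qvec :: "real ^ 'n \<Rightarrow> real ^ 'n \<Rightarrow> 'n \<Rightarrow> real" where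
  "qvec \<omega> wt i = wt $ i / (2 * \<omega> $ i)"

definition P_mat :: "real ^ 'n \<Rightarrow> real ^ 'n \<Rightarrow> real \<Rightarrow> real \<Rightarrow> real ^ 'n ^ 'n" where
  "P_mat \<omega> wt c \<alpha> = (\<chi> i j. qvec \<omega> wt j / (delta \<omega> c \<alpha> i + gamma \<omega> c \<alpha> j))"

definition Pt_mat :: "real ^ 'n \<Rightarrow> real ^ 'n \<Rightarrow> real \<Rightarrow> real \<Rightarrow> real ^ 'n ^ 'n" where
  "Pt_mat \<omega> wt c \<alpha> = (\<chi> i j. qvec \<omega> wt j / (gamma \<omega> c \<alpha> i + delta \<omega> c \<alpha> j))"

text \<open>$\mathbb R^{2n}$ is \<open>real ^ ('n + 'n)\<close>: \<open>Inl\<close> indexes the block $u$, \<open>Inr\<close> the block $v$.\<close>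

definition stack :: "real ^ 'n \<Rightarrow> real ^ 'n \<Rightarrow> real ^ ('n + 'n)" where
  "stack u v = (\<chi> k. case k of Inl i \<Rightarrow> u $ i | Inr i \<Rightarrow> v $ i)"

definition upper :: "real ^ ('n + 'n) \<Rightarrow> real ^ 'n" where
  "upper w = (\<chi> i. w $ Inl i)"

definition lower :: "real ^ ('n + 'n) \<Rightarrow> real ^ 'n" where
  "lower w = (\<chi> i. w $ Inr i)"

text \<open>On \<open>real ^ 'm\<close> the library's \<open>*\<close> is the Hadamard product and \<open>1\<close> the vector of ones.\<close>

definition riccati_map ::
    "real ^ 'n \<Rightarrow> real ^ 'n \<Rightarrow> real \<Rightarrow> real \<Rightarrow> real ^ ('n + 'n) \<Rightarrow> real ^ ('n + 'n)" where
  "riccati_map \<omega> wt c \<alpha> w =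
     w - w * stack (P_mat \<omega> wt c \<alpha> *v lower w) (Pt_mat \<omega> wt c \<alpha> *v upper w) - 1"

definition positive_solution :: "(real ^ 'm \<Rightarrow> real ^ 'm) \<Rightarrow> real ^ 'm \<Rightarrow> bool" where
  "positive_solution f w \<longleftrightarrow> f w = 0 \<and> (\<forall>i. 0 < w $ i)"

definition minimal_positive_solution :: "(real ^ 'm \<Rightarrow> real ^ 'm) \<Rightarrow> real ^ 'm \<Rightarrow> bool" where
  "minimal_positive_solution f w \<longleftrightarrow>
     positive_solution f w \<and> (\<forall>w'. positive_solution f w' \<longrightarrow> (\<forall>i. w $ i \<le> w' $ i))"


section \<open>The two-step Newton method and rates of convergence\<close>

text \<open>\<open>newton_step f w x\<close> is $x - f'(w)^{-1} f(x)$.\<close>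

definition newton_step :: "(real ^ 'm \<Rightarrow> real ^ 'm) \<Rightarrow> real ^ 'm \<Rightarrow> real ^ 'm \<Rightarrow> real ^ 'm" where
  "newton_step f w x = x - matrix_inv (jacobian f (at w)) *v f x"

primrec two_step_newton :: "(real ^ 'm \<Rightarrow> real ^ 'm) \<Rightarrow> nat \<Rightarrow> real ^ 'm" where
  "two_step_newton f 0 = 0"
| "two_step_newton f (Suc k) =
     (let w = two_step_newton f k; z = newton_step f w w in newton_step f w z)"

text \<open>\<open>matrix_inv\<close> and \<open>jacobian\<close> are total, so that the iteration is meaningful has to be
  said separately.\<close>

definition two_step_newton_well_defined :: "(real ^ 'm \<Rightarrow> real ^ 'm) \<Rightarrow> bool" where
  "two_step_newton_well_defined f \<longleftrightarrow>
     (\<forall>k. f differentiable (at (two_step_newton f k)) \<and>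
          invertible (jacobian f (at (two_step_newton f k))))"

text \<open>Convergence itself is a separate conjunct because the rate inequalities alone do not
  imply it. The norm is the maximum norm \<open>infnorm\<close>.\<close>

definition converges_Q_superquadratically ::
    "(nat \<Rightarrow> real ^ 'm) \<Rightarrow> real ^ 'm \<Rightarrow> bool" where
  "converges_Q_superquadratically w l \<longleftrightarrow> w \<longlonglongrightarrow> l \<and>
     (\<forall>\<epsilon>>0. \<exists>N. \<forall>k\<ge>N. infnorm (w (Suc k) - l) \<le> \<epsilon> * (infnorm (w k - l))\<^sup>2)"

definition converges_Q_cubically :: "(nat \<Rightarrow> real ^ 'm) \<Rightarrow> real ^ 'm \<Rightarrow> bool" where
  "converges_Q_cubically w l \<longleftrightarrow> w \<longlonglongrightarrow> l \<and>
     (\<exists>C\<ge>0. \<exists>N. \<forall>k\<ge>N. infnorm (w (Suc k) - l) \<le> C * (infnorm (w k - l)) ^ 3)"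

end

theory Submission imports Defs begin

text \<open>
  With \<open>M\<close> the nonnegative matrix having blocks \<open>P\<close> and \<open>Pt\<close> off the diagonal, the map is
  \<open>w - w * (M *v w) - 1\<close>. Orthogonality of the Legendre polynomial makes the nodes and weights
  positive and the weights sum to 1, so every row sum of \<open>M\<close> is \<^emph>\<open>strictly\<close> below
  \<open>c * (1 + \<alpha>) / 2 \<le> 1 / 4\<close>. Hence the derivative is an M-matrix, uniformly invertible on the box
  \<open>0 \<le> w \<le> 2\<close>, which contains the minimal solution (the limit of the Picard iteration from 0).
  Newton iterates increase, stay below the minimal solution and above the Picard iterates, so they
  converge to it; the exact second-order expansion of the quadratic map gives a cubic rate already
  for all \<open>c * (1 + \<alpha>) \<le> 1 / 2\<close>, and a cubic rate is superquadratic.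
\<close>

section \<open>Gauss--Legendre nodes and weights\<close>

text \<open>Each differentiation costs at most one factor \<open>p\<close>, since both summands of
  the product rule keep \<open>p ^ m\<close>. For \<open>k \<ge> n\<close> the truncated exponent is
  0.\<close>

lemma power_dvd_higher_pderiv:
  fixes p :: "'a::idom poly"
  shows "p ^ (n - k) dvd (pderiv ^^ k) (p ^ n)"
proof (induction k)
  case 0
  then show ?case by simp
next
  case (Suc k)
  show ?case
  proof (cases "k < n")
    case True
    then obtain m where m: "n - k = Suc m" by (metis Suc_diff_Suc)
    from Suc obtain s where "(pderiv ^^ k) (p ^ n) = p ^ Suc m * s"
      unfolding m by (auto elim: dvdE)
    then have "(pderiv ^^ Suc k) (p ^ n) = pderiv (p ^ Suc m * s)" by simp
    also have "p ^ m dvd \<dots>"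
      by (simp only: pderiv_mult pderiv_power_Suc)
        (auto intro!: dvd_add intro: dvd_mult dvd_smult dvd_mult2)
    also have "m = n - Suc k" using m by simp
    finally show ?thesis .
  next
    case False
    then show ?thesis by simp
  qed
qed

lemma poly_integral_by_parts:
  fixes p q :: "real poly"
  assumes "a \<le> b" "poly p a = 0" "poly p b = 0"
  shows "integral {a..b} (poly (pderiv p * q)) = - integral {a..b} (poly (p * pderiv q))"
proof -
  have "(poly (pderiv (p * q)) has_integral poly (p * q) b - poly (p * q) a) {a..b}"
    using assms(1)
    by (intro fundamental_theorem_of_calculus poly_DERIV[THEN DERIV_subset]
        has_real_derivative_iff_has_vector_derivative[THEN iffD1]) auto
  then have "integral {a..b} (poly (pderiv (p * q))) = 0"
    using assms by (simp add: integral_unique)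
  moreover have "integral {a..b} (poly (pderiv (p * q)))
      = integral {a..b} (\<lambda>x. poly (p * pderiv q) x + poly (pderiv p * q) x)"
    by (rule arg_cong[where f = "integral _"]) (auto simp: pderiv_mult mult.commute)
  moreover have "\<dots> = integral {a..b} (poly (p * pderiv q)) + integral {a..b} (poly (pderiv p * q))"
    by (intro integral_add integrable_continuous_real continuous_intros)
  ultimately show ?thesis by simp
qed

lemma higher_pderiv_eq_0:
  fixes p :: "real poly"
  assumes "degree p < k"
  shows "(pderiv ^^ k) p = 0"
  using assms
proof (induction k arbitrary: p)
  case 0
  then show ?case by simp
next
  case (Suc k)
  show ?case
  proof (cases "degree p = 0")
    case True
    then have "pderiv p = 0" by (simp add: pderiv_eq_0_iff)
    moreover have "(pderiv ^^ k) (0::real poly) = 0" by (induction k) auto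
    ultimately show ?thesis by (simp add: funpow_Suc_right del: funpow.simps)
  next
    case False
    then have "degree (pderiv p) < k" using Suc.prems by (simp add: degree_pderiv)
    then show ?thesis using Suc.IH by (simp add: funpow_Suc_right del: funpow.simps)
  qed
qed

text \<open>All derivatives are moved from \<open>R ^ n\<close> onto \<open>g\<close>; boundary
  terms vanish because fewer than \<open>n\<close> derivatives leave a factor \<open>R\<close>. A
  vanishing derivative in place of a degree bound fits the induction, which replaces
  \<open>g\<close> by \<open>pderiv g\<close>.\<close>

lemma higher_pderiv_orthogonal:
  fixes R g :: "real poly"
  assumes "k \<le> n" "(pderiv ^^ k) g = 0" "a \<le> b" "poly R a = 0" "poly R b = 0"
  shows "integral {a..b} (poly ((pderiv ^^ k) (R ^ n) * g)) = 0"
  using assms(1,2)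
proof (induction k arbitrary: g)
  case 0
  then show ?case by simp
next
  case (Suc k)
  have "poly R x = 0 \<Longrightarrow> poly ((pderiv ^^ k) (R ^ n)) x = 0" for x
  proof -
    have "R dvd R ^ (n - k)" using Suc.prems by (intro dvd_power) auto
    then have "R dvd (pderiv ^^ k) (R ^ n)"
      using power_dvd_higher_pderiv dvd_trans by blast
    then show "poly R x = 0 \<Longrightarrow> poly ((pderiv ^^ k) (R ^ n)) x = 0" by (auto elim: dvdE)
  qed
  then have "integral {a..b} (poly ((pderiv ^^ Suc k) (R ^ n) * g))
      = - integral {a..b} (poly ((pderiv ^^ k) (R ^ n) * pderiv g))"
    using poly_integral_by_parts[OF assms(3), of "(pderiv ^^ k) (R ^ n)" g] assms(4,5) by simp
  also have "\<dots> = 0"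
    using Suc.IH[of "pderiv g"] Suc.prems by (simp add: funpow_Suc_right del: funpow.simps poly_mult)
  finally show ?case .
qed

lemma shifted_legendre_orthogonal:
  assumes "degree g < n"
  shows "integral {0..1} (poly (shifted_legendre n * g)) = 0"
proof -
  have "integral {0..1} (poly ((pderiv ^^ n) ([:0, -1, 1:] ^ n) * g)) = 0"
    using assms by (intro higher_pderiv_orthogonal higher_pderiv_eq_0) auto
  moreover have "poly (shifted_legendre n * g)
      = (\<lambda>x. 1 / fact n * poly ((pderiv ^^ n) ([:0, -1, 1:] ^ n) * g) x)"
    by (rule ext) (simp add: shifted_legendre_def)
  ultimately show ?thesis by (simp only: integral_mult_right mult_zero_right)
qed

lemma degree_shifted_legendre: "degree (shifted_legendre n) = n"
  by (simp add: shifted_legendre_def degree_higher_pderiv degree_power_eq)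

section \<open>Positive integrals, root factors and Lagrange polynomials\<close>

text \<open>A nonnegative continuous function with zero integral vanishes on the whole interval,
  which would give \<open>p\<close> infinitely many roots.\<close>

lemma poly_integral_pos:
  fixes p :: "real poly"
  assumes "p \<noteq> 0" "a < b" "\<And>x. x \<in> {a..b} \<Longrightarrow> 0 \<le> poly p x"
  shows "0 < integral {a..b} (poly p)"
proof -
  have "integral {a..b} (poly p) \<noteq> 0"
  proof
    assume "integral {a..b} (poly p) = 0"
    moreover have "poly p integrable_on {a..b}"
      by (intro integrable_continuous_real continuous_on_poly continuous_on_id)
    ultimately have "(poly p has_integral 0) (cbox a b)"
      by (simp add: has_integral_integrable_integral)
    then have "poly p x = 0" if "x \<in> {a..b}" for x
      by (rule has_integral_0_cbox_imp_0[of a b "poly p", rotated 2])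
        (use assms that in \<open>auto intro: continuous_on_poly continuous_on_id\<close>)
    then have "{a..b} \<subseteq> {x. poly p x = 0}" by auto
    then show False
      using poly_roots_finite[OF assms(1)] assms(2) infinite_Icc finite_subset by blast
  qed
  moreover have "0 \<le> integral {a..b} (poly p)"
    by (intro integral_nonneg integrable_continuous_real continuous_intros assms)
  ultimately show ?thesis by simp
qed

text \<open>The product over the earlier roots does not vanish at the new one, so in a domain the
  cofactor must.\<close>

lemma prod_linear_factors_dvd:
  fixes p :: "'a::idom poly"
  assumes "finite A" "\<And>x. x \<in> A \<Longrightarrow> poly p x = 0"
  shows "(\<Prod>x\<in>A. [:- x, 1:]) dvd p"
  using assms
proof (induction A rule: finite_induct)
  case (insert x A)
  then obtain t where t: "p = (\<Prod>y\<in>A. [:- y, 1:]) * t" by (auto elim: dvdE)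
  have "poly (\<Prod>y\<in>A. [:- y, 1:]) x \<noteq> 0"
    using insert.hyps by (auto simp: poly_prod)
  then have "poly t x = 0" using t insert.prems[of x] by simp
  then have "[:- x, 1:] dvd t" by (simp add: poly_eq_0_iff_dvd)
  then have "[:- x, 1:] * (\<Prod>y\<in>A. [:- y, 1:]) dvd t * (\<Prod>y\<in>A. [:- y, 1:])"
    by (rule mult_dvd_mono) simp
  then show ?case using insert.hyps
    by (simp only: t prod.insert mult.commute[of _ t] not_False_eq_True)
qed auto

text \<open>The polynomial behind the function \<open>lagrange_basis\<close>, so that degree and
  divisibility arguments apply.\<close>

definition lagrange_poly :: "real ^ 'n \<Rightarrow> 'n \<Rightarrow> real poly" where
  "lagrange_poly \<omega> i = (\<Prod>j\<in>UNIV - {i}. smult (1 / (\<omega> $ i - \<omega> $ j)) [:- \<omega> $ j, 1:])"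

lemma poly_lagrange_poly: "poly (lagrange_poly \<omega> i) = lagrange_basis \<omega> i"
  by (rule ext) (simp add: lagrange_poly_def lagrange_basis_def poly_prod diff_divide_distrib)

lemma degree_lagrange_poly: "degree (lagrange_poly \<omega> i) < CARD('n)" for \<omega> :: "real ^ 'n"
proof -
  have "degree (lagrange_poly \<omega> i)
      \<le> (\<Sum>j\<in>UNIV - {i}. degree (smult (1 / (\<omega> $ i - \<omega> $ j)) [:- \<omega> $ j, 1:]))"
    unfolding lagrange_poly_def by (rule order.trans[OF degree_prod_sum_le]) auto
  also have "\<dots> \<le> (\<Sum>j\<in>UNIV - {i}. 1)" by (intro sum_mono) simp
  also have "\<dots> < CARD('n)" by (simp add: card_Diff_singleton)
  finally show ?thesis .
qed

lemma lagrange_basis_node: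
  assumes "inj (($) \<omega>)"
  shows "lagrange_basis \<omega> i (\<omega> $ j) = (if i = j then 1 else 0)"
proof (cases "i = j")
  case True
  then show ?thesis using assms unfolding lagrange_basis_def
    by (intro trans[OF prod.neutral]) (auto simp: inj_eq)
next
  case False
  then show ?thesis unfolding lagrange_basis_def by (auto intro!: prod_zero)
qed

section \<open>Gaussian exactness, positive nodes and weights\<close>

context
  fixes \<omega> wt :: "real ^ 'n::{finite,linorder}"
  assumes gl: "gauss_legendre \<omega> wt"
begin

lemma gauss_nodes_inj: "inj (($) \<omega>)"
  using gl unfolding gauss_legendre_def inj_def by (metis less_irrefl linorder_neqE)

text \<open>Gaussian exactness for polynomials with zero quadrature sum. The nodal polynomial
  \<open>W\<close> divides \<open>q\<close>, the cofactor has degree below \<open>CARD('n)\<close>,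
  and \<open>W\<close> is the Legendre polynomial up to a constant, so orthogonality
  applies.\<close>

lemma gauss_quadrature_exact_vanishing:
  assumes "\<And>i. poly q (\<omega> $ i) = 0" "degree q < 2 * CARD('n)"
  shows "integral {0..1} (poly q) = 0"
proof (cases "q = 0")
  case False
  define W where "W = (\<Prod>x\<in>range (($) \<omega>). [:- x, 1:])"
  have degW: "degree W = CARD('n)"
    unfolding W_def using gauss_nodes_inj by (simp add: degree_prod_eq_sum_degree card_image)
  have W_dvd: "W dvd p" if "\<And>i. poly p (\<omega> $ i) = 0" for p
    unfolding W_def by (rule prod_linear_factors_dvd) (use that in auto)
  define P where "P = shifted_legendre CARD('n)"
  have degP: "degree P = CARD('n)" by (simp add: P_def degree_shifted_legendre)
  have "W dvd P" using gl by (intro W_dvd) (simp add: P_def gauss_legendre_def)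
  then obtain t where t: "P = W * t" by (auto elim: dvdE)
  have "P \<noteq> 0" using degP by auto
  then have "t \<noteq> 0" "W \<noteq> 0" using t by auto
  \<comment> \<open>Equal degrees of \<open>P\<close> and \<open>W\<close> leave only a constant
    cofactor, nonzero since \<open>P \<noteq> 0\<close>.\<close>
  then have "degree t = 0" using degP degW t by (simp add: degree_mult_eq)
  then obtain a where a: "t = [:a:]" by (metis degree_eq_zeroE)
  obtain s where s: "q = W * s" using W_dvd[of q] assms by (auto elim: dvdE)
  have "degree s < CARD('n)"
    using s False assms(2) degW by (auto simp: degree_mult_eq)
  then have "integral {0..1} (poly (P * s)) = 0" 
    unfolding P_def by (rule shifted_legendre_orthogonal)
  moreover have "poly (P * s) = (\<lambda>x. a * poly q x)" by (auto simp: t a s)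
  ultimately show ?thesis using \<open>t \<noteq> 0\<close> a by simp
next
  case True
  moreover have "poly (0::real poly) = (\<lambda>x. 0)" by auto
  ultimately show ?thesis by simp
qed

text \<open>The linear factor at node \<open>i\<close> times the squared Lagrange polynomial has
  degree at most \<open>2 * CARD('n) - 1\<close> and vanishes at all nodes, so its integral is 0. A
  node \<open>\<le> 0\<close> would make it nonnegative on the unit interval, with positive
  integral.\<close>

lemma gauss_nodes_pos: "0 < \<omega> $ i"
proof (rule ccontr)
  assume "\<not> 0 < \<omega> $ i"
  let ?q = "[:- \<omega> $ i, 1:] * (lagrange_poly \<omega> i)\<^sup>2"
  have "lagrange_poly \<omega> i \<noteq> 0"
    using lagrange_basis_node[OF gauss_nodes_inj, of i i] poly_lagrange_poly[of \<omega> i]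
    by (metis poly_0 zero_neq_one)
  then have ne: "?q \<noteq> 0" by (metis mult_eq_0_iff pCons_eq_0_iff power_not_zero zero_neq_one)
  have "degree ?q = 1 + 2 * degree (lagrange_poly \<omega> i)"
    using ne \<open>lagrange_poly \<omega> i \<noteq> 0\<close>
    by (subst degree_mult_eq) (simp_all add: degree_power_eq del: mult_pCons_left)
  then have "degree ?q < 2 * CARD('n)" using degree_lagrange_poly[of \<omega> i] by linarith
  then have "integral {0..1} (poly ?q) = 0"
    by (intro gauss_quadrature_exact_vanishing)
      (auto simp: poly_lagrange_poly lagrange_basis_node[OF gauss_nodes_inj])
  moreover have "0 < integral {0..1} (poly ?q)"
  proof (intro poly_integral_pos ne)
    fix x :: real
    assume "x \<in> {0..1}"
    then have "0 \<le> (x - \<omega> $ i) * (poly (lagrange_poly \<omega> i) x)\<^sup>2"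
      using \<open>\<not> 0 < \<omega> $ i\<close> by (intro mult_nonneg_nonneg) auto
    then show "0 \<le> poly ?q x" by (simp add: algebra_simps)
  qed auto
  ultimately show False by simp
qed

text \<open>At the nodes \<open>?L\<close> is 0 or 1, so \<open>?L - ?L\<^sup>2\<close> vanishes
  there; by exactness the weight equals the integral of the square.\<close>

lemma gauss_weights_pos: "0 < wt $ i"
proof -
  let ?L = "lagrange_poly \<omega> i"
  have ne: "?L \<noteq> 0"
    using lagrange_basis_node[OF gauss_nodes_inj, of i i] poly_lagrange_poly[of \<omega> i]
    by (metis poly_0 zero_neq_one)
  have "degree (?L - ?L\<^sup>2) < 2 * CARD('n)"
    using degree_lagrange_poly[of \<omega> i] by (intro degree_diff_less) (auto simp: degree_power_eq ne)
  then have "integral {0..1} (poly (?L - ?L\<^sup>2)) = 0"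
    by (intro gauss_quadrature_exact_vanishing)
      (auto simp: poly_lagrange_poly lagrange_basis_node[OF gauss_nodes_inj])
  moreover have "integral {0..1} (poly (?L - ?L\<^sup>2))
      = integral {0..1} (poly ?L) - integral {0..1} (poly (?L\<^sup>2))"
    unfolding poly_diff
    by (intro integral_diff integrable_continuous_real continuous_intros)
  moreover have "0 < integral {0..1} (poly (?L\<^sup>2))"
    using ne by (intro poly_integral_pos) auto
  ultimately show ?thesis using gl by (simp add: gauss_legendre_def poly_lagrange_poly)
qed

text \<open>The Lagrange polynomials sum to 1 at every node. The crude degree bound
  \<open>CARD('n)\<close> on the difference is within the range of exactness.\<close>

lemma gauss_weights_sum: "(\<Sum>i\<in>UNIV. wt $ i) = 1"
proof -
  let ?S = "(\<Sum>i\<in>UNIV. lagrange_poly \<omega> i) - 1"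
  have "degree ?S \<le> CARD('n)"
    using degree_lagrange_poly[of \<omega>]
    by (intro degree_diff_le degree_sum_le) (auto intro: less_imp_le)
  moreover have "0 < CARD('n)" by (rule zero_less_card_finite)
  ultimately have "degree ?S < 2 * CARD('n)" by linarith
  then have "integral {0..1} (poly ?S) = 0"
    by (intro gauss_quadrature_exact_vanishing)
      (simp_all add: poly_lagrange_poly poly_sum lagrange_basis_node[OF gauss_nodes_inj])
  moreover have "((\<lambda>x. (\<Sum>i\<in>UNIV. lagrange_basis \<omega> i x) - 1) has_integral (\<Sum>i\<in>UNIV. wt $ i) - 1) {0..1}"
  proof (intro has_integral_diff has_integral_sum finite)
    fix i
    have "poly (lagrange_poly \<omega> i) integrable_on {0..1}"
      by (intro integrable_continuous_real continuous_on_poly continuous_on_id)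
    then show "(lagrange_basis \<omega> i has_integral wt $ i) {0..1}"
      using gl by (simp add: gauss_legendre_def poly_lagrange_poly has_integral_integrable_integral)
    show "((\<lambda>x. 1 :: real) has_integral 1) {0..1::real}"
      using has_integral_const_real[of "1::real" 0 1] by simp
  qed
  moreover have "poly ?S = (\<lambda>x. (\<Sum>i\<in>UNIV. lagrange_basis \<omega> i x) - 1)"
    by (rule ext) (simp only: poly_diff poly_sum poly_1 poly_lagrange_poly)
  ultimately show ?thesis by (simp add: integral_unique)
qed

end


section \<open>Quadratic maps with a small nonnegative matrix\<close>

lemma infnorm_le_iff_cart: "infnorm x \<le> b \<longleftrightarrow> (\<forall>i. \<bar>x $ i\<bar> \<le> b)" for x :: "real ^ 'm"
proof -
  have "{\<bar>x $ i\<bar> |i. i \<in> UNIV} = range (\<lambda>i. \<bar>x $ i\<bar>)" by auto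
  then show ?thesis by (simp add: infnorm_cart cSup_eq_Max)
qed

lemma infnorm_mono_cart:
  "0 \<le> x \<Longrightarrow> x \<le> y \<Longrightarrow> infnorm x \<le> infnorm y" for x y :: "real ^ 'm"
  unfolding infnorm_le_iff_cart
  by (metis abs_of_nonneg component_le_infnorm_cart less_eq_vec_def order_trans zero_index)

lemma infnorm_times_le: "infnorm (x * y) \<le> infnorm x * infnorm y" for x y :: "real ^ 'm"
  unfolding infnorm_le_iff_cart
  by (auto simp: abs_mult intro!: mult_mono component_le_infnorm_cart infnorm_pos_le)

lemma times_vec_nonneg: "0 \<le> x \<Longrightarrow> 0 \<le> y \<Longrightarrow> 0 \<le> x * y" for x y :: "real ^ 'm"
  by (simp add: less_eq_vec_def)

text \<open>One factor of the error, times \<open>C\<close>, tends to 0 and is eventually below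
  \<epsilon>.\<close>

lemma cubic_imp_superquadratic:
  fixes w :: "nat \<Rightarrow> real ^ 'm"
  assumes "converges_Q_cubically w l"
  shows "converges_Q_superquadratically w l"
proof -
  from assms obtain C N where lim: "w \<longlonglongrightarrow> l" and C: "0 \<le> C"
    and N: "\<And>k. k \<ge> N \<Longrightarrow> infnorm (w (Suc k) - l) \<le> C * infnorm (w k - l) ^ 3"
    unfolding converges_Q_cubically_def by blast
  show ?thesis
    unfolding converges_Q_superquadratically_def
  proof (intro conjI allI impI lim)
    fix \<epsilon> :: real
    assume "0 < \<epsilon>"
    have "(\<lambda>k. C * infnorm (w k - l)) \<longlonglongrightarrow> C * infnorm (l - l)"
      by (intro tendsto_intros lim)
    then have "(\<lambda>k. C * infnorm (w k - l)) \<longlonglongrightarrow> 0" by (simp add: infnorm_0)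
    then have "\<forall>\<^sub>F k in sequentially. C * infnorm (w k - l) < \<epsilon>"
      using \<open>0 < \<epsilon>\<close> by (rule order_tendstoD(2))
    then obtain K where K: "\<And>k. k \<ge> K \<Longrightarrow> C * infnorm (w k - l) < \<epsilon>"
      by (auto simp: eventually_sequentially)
    show "\<exists>N. \<forall>k\<ge>N. infnorm (w (Suc k) - l) \<le> \<epsilon> * (infnorm (w k - l))\<^sup>2"
    proof (intro exI allI impI)
      fix k
      assume k: "max K N \<le> k"
      have "infnorm (w (Suc k) - l) \<le> C * infnorm (w k - l) * (infnorm (w k - l))\<^sup>2"
        using N[of k] k by (simp add: power3_eq_cube power2_eq_square mult.assoc)
      also have "\<dots> \<le> \<epsilon> * (infnorm (w k - l))\<^sup>2"
        using K[of k] k by (intro mult_right_mono) auto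
      finally show "infnorm (w (Suc k) - l) \<le> \<epsilon> * (infnorm (w k - l))\<^sup>2" .
    qed
  qed
qed

section \<open>The quadratic map and its derivative\<close>

text \<open>The bound 1/4 matches the box \<open>infnorm w \<le> 2\<close>: each of the two products
  in the derivative is at most \<open>2 * m\<close> times the argument, leaving the margin
  \<open>1 - 4 * m > 0\<close>.\<close>

locale small_nonneg_matrix =
  fixes M :: "real ^ 'm ^ 'm" and m :: real
  assumes entry_nonneg: "0 \<le> M $ i $ j"
    and row_sum_le: "(\<Sum>j\<in>UNIV. M $ i $ j) \<le> m"
    and m_small: "m < 1 / 4"
begin

definition F :: "real ^ 'm \<Rightarrow> real ^ 'm" where
  "F w = w - w * (M *v w) - 1"

definition D :: "real ^ 'm \<Rightarrow> real ^ 'm \<Rightarrow> real ^ 'm" where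
  "D w h = h - h * (M *v w) - w * (M *v h)"

text \<open>Since \<open>F w = w - picard w\<close>, zeros of \<open>F\<close> are fixed points, and
  \<open>F w \<le> 0\<close> means \<open>w \<le> picard w\<close>.\<close>

definition picard :: "real ^ 'm \<Rightarrow> real ^ 'm" where
  "picard x = 1 + x * (M *v x)"

lemma m_nonneg: "0 \<le> m"
  using row_sum_le sum_nonneg[of UNIV "\<lambda>j. M $ undefined $ j"] entry_nonneg order_trans by blast

lemma matrix_vec_nonneg: "0 \<le> x \<Longrightarrow> 0 \<le> M *v x"
  by (auto simp: less_eq_vec_def matrix_vector_mult_def entry_nonneg intro!: sum_nonneg)

lemma matrix_vec_mono: "x \<le> y \<Longrightarrow> M *v x \<le> M *v y"
  using matrix_vec_nonneg[of "y - x"] by (simp add: algebra_simps)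

lemma infnorm_matrix_vec: "infnorm (M *v x) \<le> m * infnorm x"
  unfolding infnorm_le_iff_cart
proof
  fix i
  have "\<bar>(M *v x) $ i\<bar> \<le> (\<Sum>j\<in>UNIV. \<bar>M $ i $ j * x $ j\<bar>)"
    unfolding matrix_vector_mult_def by (simp add: sum_abs)
  also have "\<dots> \<le> (\<Sum>j\<in>UNIV. M $ i $ j * infnorm x)"
    by (intro sum_mono) (simp add: abs_mult entry_nonneg component_le_infnorm_cart mult_left_mono)
  also have "\<dots> \<le> m * infnorm x"
    unfolding sum_distrib_right[symmetric]
    by (intro mult_right_mono row_sum_le infnorm_pos_le)
  finally show "\<bar>(M *v x) $ i\<bar> \<le> m * infnorm x" .
qed

text \<open>The Taylor expansion is exact because \<open>F\<close> is quadratic.\<close>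

lemma F_add: "F (x + h) = F x + D x h - h * (M *v h)"
  by (simp add: F_def D_def algebra_simps)

text \<open>\<open>D\<close> is affine in its base point. This moves a derivative at the
  intermediate Newton point back to the point whose Jacobian is reused.\<close>

lemma D_diff_base: "D x h = D w h - h * (M *v (x - w)) - (x - w) * (M *v h)"
  by (simp add: D_def algebra_simps)

lemma D_linear: "linear (D w)"
  by (intro linearI)
    (simp_all add: D_def algebra_simps vec_eq_iff matrix_vector_mult_scaleR)

lemma F_has_derivative: "(F has_derivative D w) (at w)"
proof -
  have "((\<lambda>x. F x $ i) has_derivative (\<lambda>h. D w h $ i)) (at w)" for i
    unfolding F_def D_def matrix_vector_mult_def
    by (auto intro!: derivative_eq_intros bounded_linear_imp_has_derivative
        bounded_linear_vec_nth ext simp: algebra_simps)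
  then show ?thesis
    by (subst has_derivative_componentwise_within) (auto simp: Basis_vec_def inner_axis)
qed

lemma F_differentiable: "F differentiable (at w)"
  using F_has_derivative by (rule differentiableI)

lemma jacobian_F: "jacobian F (at w) *v h = D w h"
  using jacobian_works[of F "at w"] F_differentiable F_has_derivative has_derivative_unique
  by metis

text \<open>A discrete minimum principle: at an index \<open>i\<close> where \<open>y\<close> is
  smallest and negative, component \<open>i\<close> of \<open>D w y\<close> is at most
  \<open>(1 - 4 * m) * y $ i < 0\<close>.\<close>

lemma D_inverse_nonneg:
  assumes w: "0 \<le> w" "infnorm w \<le> 2" and D: "0 \<le> D w y"
  shows "0 \<le> y"
proof -
  obtain i where i: "\<And>j. y $ i \<le> y $ j"
    using ex_min_if_finite[of "range (($) y)"] by (auto simp: not_less)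
  have "\<not> y $ i < 0"
  proof
    assume neg: "y $ i < 0"
    have Mw: "(M *v w) $ i \<le> 2 * m"
      using infnorm_matrix_vec[of w] component_le_infnorm_cart[of "M *v w" i] w m_nonneg
        mult_left_mono[OF w(2) m_nonneg] by linarith
    have wi: "0 \<le> w $ i" "w $ i \<le> 2"
      using w component_le_infnorm_cart[of w i] by (auto simp: less_eq_vec_def)
    have "m * y $ i \<le> (\<Sum>j\<in>UNIV. M $ i $ j) * y $ i"
      using neg row_sum_le by (intro mult_right_mono_neg) auto
    also have "\<dots> \<le> (M *v y) $ i"
      unfolding matrix_vector_mult_def sum_distrib_right
      by (auto intro!: sum_mono mult_left_mono i entry_nonneg)
    finally have My: "m * y $ i \<le> (M *v y) $ i" .
    have "m * y $ i \<le> 0" using neg m_nonneg by (simp add: mult_nonneg_nonpos)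
    then have "2 * (m * y $ i) \<le> w $ i * (m * y $ i)"
      using wi by (intro mult_right_mono_neg) auto
    also have "\<dots> \<le> w $ i * (M *v y) $ i" using My wi by (intro mult_left_mono)
    finally have 1: "2 * m * y $ i \<le> w $ i * (M *v y) $ i" by simp
    have 2: "2 * m * y $ i \<le> y $ i * (M *v w) $ i"
      using mult_right_mono_neg[OF Mw, of "y $ i"] neg by (simp add: mult.commute)
    have "0 \<le> y $ i - y $ i * (M *v w) $ i - w $ i * (M *v y) $ i"
      using D by (simp add: D_def less_eq_vec_def)
    then have "0 \<le> (1 - 4 * m) * y $ i" using 1 2 by (simp add: algebra_simps)
    then show False using neg m_small by (simp add: zero_le_mult_iff)
  qed
  then show ?thesis using i unfolding less_eq_vec_def zero_index by (meson not_less order_trans)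
qed

text \<open>Reverse triangle inequality. It yields both injectivity of the Jacobian and the error
  estimates.\<close>

lemma D_infnorm_ge:
  assumes w: "infnorm w \<le> 2"
  shows "(1 - 4 * m) * infnorm y \<le> infnorm (D w y)"
proof -
  have "y = D w y + y * (M *v w) + w * (M *v y)" by (simp add: D_def)
  then have "infnorm y \<le> infnorm (D w y) + infnorm (y * (M *v w)) + infnorm (w * (M *v y))"
    using infnorm_triangle[of "D w y + y * (M *v w)" "w * (M *v y)"]
      infnorm_triangle[of "D w y" "y * (M *v w)"] by simp
  moreover have "infnorm (y * (M *v w)) \<le> infnorm y * (m * 2)"
    using infnorm_matrix_vec[of w] mult_left_mono[OF w m_nonneg]
    by (intro order_trans[OF infnorm_times_le] mult_left_mono infnorm_pos_le) linarith
  moreover have "infnorm (w * (M *v y)) \<le> 2 * (m * infnorm y)"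
    by (intro order_trans[OF infnorm_times_le] mult_mono w infnorm_matrix_vec infnorm_pos_le) auto
  ultimately show ?thesis by (simp add: algebra_simps)
qed

lemma jacobian_invertible:
  assumes "infnorm w \<le> 2"
  shows "invertible (jacobian F (at w))"
  unfolding invertible_left_inverse matrix_left_invertible_ker jacobian_F
proof (intro allI impI)
  fix y
  assume "D w y = 0"
  then have "(1 - 4 * m) * infnorm y \<le> 0" using D_infnorm_ge[OF assms, of y] by (simp add: infnorm_0)
  then have "infnorm y \<le> 0" using m_small by (simp add: mult_le_0_iff)
  then show "y = 0" using infnorm_pos_le[of y] infnorm_eq_0[of y] by simp
qed

text \<open>The step as solution of a linear equation; the convergence argument uses only this form,
  never the inverse matrix.\<close>

lemma D_newton_step:
  assumes "infnorm w \<le> 2"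
  shows "D w (newton_step F w x - x) = - F x"
proof -
  let ?J = "jacobian F (at w)"
  have "?J ** matrix_inv ?J = mat 1"
    using jacobian_invertible[OF assms] unfolding invertible_def matrix_inv_def
    by (metis (mono_tags, lifting) someI_ex)
  then have "?J *v (matrix_inv ?J *v F x) = F x"
    by (simp add: matrix_vector_mul_assoc)
  then have "D w (matrix_inv ?J *v F x) = F x" by (simp only: jacobian_F)
  then show ?thesis using linear_neg[OF D_linear] by (simp add: newton_step_def)
qed

section \<open>Picard iteration and the minimal solution\<close>

lemma picard_mono: "0 \<le> x \<Longrightarrow> x \<le> y \<Longrightarrow> picard x \<le> picard y"
  unfolding picard_def
  using matrix_vec_mono[of x y] matrix_vec_nonneg[of x]
  by (auto simp: less_eq_vec_def intro!: mult_mono intro: order_trans)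

text \<open>Monotone iteration from 0 under a supersolution \<open>u\<close>. Any nonnegative
  solution can serve as \<open>u\<close>, which later gives minimality.\<close>

lemma picard_iterates:
  assumes "0 \<le> u" "picard u \<le> u"
  shows "0 \<le> (picard ^^ k) 0" "(picard ^^ k) 0 \<le> (picard ^^ Suc k) 0" "(picard ^^ k) 0 \<le> u"
proof -
  have nn: "0 \<le> picard x" if "0 \<le> x" for x
    unfolding picard_def using that times_vec_nonneg matrix_vec_nonneg
    by (auto simp: less_eq_vec_def intro!: add_nonneg_nonneg)
  show 1: "0 \<le> (picard ^^ k) 0" for k by (induction k) (auto intro: nn)
  show "(picard ^^ k) 0 \<le> (picard ^^ Suc k) 0"
    by (induction k) (auto intro: nn picard_mono 1)
  show "(picard ^^ k) 0 \<le> u"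
  proof (induction k)
    case (Suc k)
    then show ?case using picard_mono[OF 1 Suc] assms(2) by simp
  qed (use assms in simp)
qed

lemma tendsto_picard:
  assumes "x \<longlonglongrightarrow> s"
  shows "(\<lambda>k. picard (x k)) \<longlonglongrightarrow> picard s"
  unfolding picard_def matrix_vector_mult_def using assms
  by (intro vec_tendstoI) (auto intro!: tendsto_intros)

text \<open>The inequality on \<open>r\<close> makes the constant vector \<open>r\<close> a
  supersolution. The increasing iterates then converge to a fixed point below every nonnegative
  supersolution, hence below every positive solution and below \<open>r\<close>.\<close>

lemma minimal_solution_picard:
  assumes r: "0 \<le> r" "1 + m * r\<^sup>2 \<le> r"
  obtains s where "(\<lambda>k. (picard ^^ k) 0) \<longlonglongrightarrow> s" "minimal_positive_solution F s" "infnorm s \<le> r"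
proof -
  let ?x = "\<lambda>k. (picard ^^ k) 0"
  define u :: "real ^ 'm" where "u = (\<chi> i. r)"
  have u: "0 \<le> u" using r by (simp add: u_def less_eq_vec_def)
  have "infnorm u \<le> r" unfolding infnorm_le_iff_cart using r by (simp add: u_def)
  have "picard u \<le> u"
    unfolding less_eq_vec_def
  proof
    fix i
    have "(M *v u) $ i \<le> m * r"
      using component_le_infnorm_cart[of "M *v u" i] infnorm_matrix_vec[of u]
        mult_left_mono[OF \<open>infnorm u \<le> r\<close> m_nonneg] by linarith
    then have "r * (M *v u) $ i \<le> r * (m * r)" using r by (intro mult_left_mono)
    then show "picard u $ i \<le> u $ i"
      using r by (simp add: picard_def u_def power2_eq_square algebra_simps)
  qed
  note x = picard_iterates[OF u this]
  have "\<exists>l. (\<lambda>k. ?x k $ i) \<longlonglongrightarrow> l" for i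
  proof -
    have "incseq (\<lambda>k. ?x k $ i)" using x(2) by (intro incseq_SucI) (simp add: less_eq_vec_def)
    then show ?thesis
      using incseq_convergent[of "\<lambda>k. ?x k $ i" "u $ i"] x(3) by (metis less_eq_vec_def)
  qed
  then obtain l where l: "\<And>i. (\<lambda>k. ?x k $ i) \<longlonglongrightarrow> l i" by metis
  define s :: "real ^ 'm" where "s = (\<chi> i. l i)"
  have lim: "?x \<longlonglongrightarrow> s" using l by (intro vec_tendstoI) (simp add: s_def)
  have "(\<lambda>k. ?x (Suc k)) \<longlonglongrightarrow> picard s" using tendsto_picard[OF lim] by simp
  then have fp: "picard s = s" using lim LIMSEQ_Suc LIMSEQ_unique by blast
  have below: "s \<le> v" if "0 \<le> v" "picard v \<le> v" for v
    unfolding less_eq_vec_def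
  proof
    fix i
    have "?x k $ i \<le> v $ i" for k
      using picard_iterates(3)[OF that, of k] unfolding less_eq_vec_def by blast
    then show "s $ i \<le> v $ i"
      by (intro LIMSEQ_le_const2[OF tendsto_vec_nth[OF lim]]) blast
  qed
  have "0 \<le> s"
    unfolding less_eq_vec_def
  proof
    fix i
    show "0 $ i \<le> s $ i"
      using x(1) unfolding less_eq_vec_def
      by (intro LIMSEQ_le_const[OF tendsto_vec_nth[OF lim]]) blast
  qed
  have "0 < s $ i" for i
  proof -
    have "0 \<le> (s * (M *v s)) $ i"
      using times_vec_nonneg[OF \<open>0 \<le> s\<close> matrix_vec_nonneg[OF \<open>0 \<le> s\<close>]] by (simp add: less_eq_vec_def)
    \<comment> \<open>The constant term of \<open>picard\<close> gives strict positivity.\<close>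
    then have "1 \<le> picard s $ i" by (simp add: picard_def)
    then show ?thesis by (simp add: fp)
  qed
  moreover have "F v = 0 \<longleftrightarrow> picard v = v" for v
    by (auto simp: F_def picard_def algebra_simps)
  ultimately have "minimal_positive_solution F s"
    unfolding minimal_positive_solution_def positive_solution_def
    using fp below by (auto simp: less_eq_vec_def less_imp_le)
  moreover have "infnorm s \<le> r"
    using below[OF u \<open>picard u \<le> u\<close>] infnorm_mono_cart[OF \<open>0 \<le> s\<close>] \<open>infnorm u \<le> r\<close> order_trans by blast
  ultimately show ?thesis using that lim by blast
qed

section \<open>One cycle of the two-step Newton method and its convergence\<close>

text \<open>Every difference needed is sent by \<open>D w\<close> to a nonnegative vector, so
  inverse positivity gives \<open>w \<le> z \<le> w' \<le> s\<close>. In the rate, 3 counts the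
  products in \<open>Dsw'\<close>, and the squared denominator comes from two uses of
  \<open>D_infnorm_ge\<close>.\<close>

lemma two_step_newton_step:
  assumes s: "F s = 0" "infnorm s \<le> 2" and w: "0 \<le> w" "w \<le> s" "F w \<le> 0"
  defines "z \<equiv> newton_step F w w"
  defines "w' \<equiv> newton_step F w z"
  shows "0 \<le> w'" "w' \<le> s" "F w' \<le> 0" "picard w \<le> w'"
    "infnorm (w' - s) \<le> 3 * m\<^sup>2 / (1 - 4 * m)\<^sup>2 * infnorm (w - s) ^ 3"
proof -
  have w2: "infnorm w \<le> 2" using infnorm_mono_cart[OF w(1,2)] s(2) by simp
  note nonneg = D_inverse_nonneg[OF w(1) w2]
  have mult_nn: "0 \<le> a * (M *v b)" if "0 \<le> a" "0 \<le> b" for a b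
    using that by (intro times_vec_nonneg matrix_vec_nonneg)
  have sw: "0 \<le> s - w" using w(2) by simp
  have Dadd: "D w (a + b) = D w a + D w b" for a b by (rule linear_add[OF D_linear])
  have Dz: "D w (z - w) = - F w" unfolding z_def by (rule D_newton_step[OF w2])
  have Dw': "D w (w' - z) = - F z" unfolding w'_def by (rule D_newton_step[OF w2])
  have zw: "0 \<le> z - w" by (rule nonneg) (use w(3) in \<open>simp add: Dz\<close>)
  \<comment> \<open>The Newton equation cancels the affine part of the expansion at
    \<open>w\<close>.\<close>
  have Fz: "F z = - ((z - w) * (M *v (z - w)))"
    using F_add[of w "z - w"] Dz by simp
  have "0 \<le> - F z" unfolding Fz minus_minus by (intro mult_nn zw)
  then have w'z: "0 \<le> w' - z" unfolding Dw'[symmetric] by (rule nonneg)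
  \<comment> \<open>Expanding \<open>F s = 0\<close> at \<open>w\<close> and subtracting the Newton
    equation leaves the quadratic term.\<close>
  have Dsz: "D w (s - z) = (s - w) * (M *v (s - w))"
    using F_add[of w "s - w"] Dz s(1) Dadd[of "s - z" "z - w"] by (simp add: algebra_simps)
  have sz: "0 \<le> s - z" by (rule nonneg, unfold Dsz) (intro mult_nn sw)
  have "F s = F z + D z (s - z) - (s - z) * (M *v (s - z))"
    using F_add[of z "s - z"] by simp
  \<comment> \<open>The expansion is at \<open>z\<close> but the second step uses the Jacobian at
    \<open>w\<close>; the change of base point produces the mixed products.\<close>
  then have Dsw': "D w (s - w') = (s - z) * (M *v (z - w)) + (z - w) * (M *v (s - z))
      + (s - z) * (M *v (s - z))"
    using D_diff_base[of z "s - z" w] Dw' s(1) Dadd[of "s - w'" "w' - z"] by (simp add: algebra_simps)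
  have sw': "0 \<le> s - w'"
    by (rule nonneg, unfold Dsw') (intro add_nonneg_nonneg mult_nn zw sz)
  show "w' \<le> s" using sw' by simp
  show "0 \<le> w'" using w(1) zw w'z by simp
  have "F w' = F z + D z (w' - z) - (w' - z) * (M *v (w' - z))"
    using F_add[of z "w' - z"] by simp
  also have "\<dots> = - ((w' - z) * (M *v (z - w)) + (z - w) * (M *v (w' - z))
      + (w' - z) * (M *v (w' - z)))"
    using D_diff_base[of z "w' - z" w] Dw' by simp
  also have "\<dots> \<le> 0"
    unfolding neg_le_0_iff_le by (intro add_nonneg_nonneg mult_nn zw w'z)
  finally show "F w' \<le> 0" .
  \<comment> \<open>The Newton correction dominates the Picard correction \<open>- F w\<close>, so a
    cycle gains at least one Picard step.\<close>
  have "z - w = - F w + ((z - w) * (M *v w) + w * (M *v (z - w)))"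
    using Dz by (simp add: D_def algebra_simps)
  moreover have "0 \<le> (z - w) * (M *v w) + w * (M *v (z - w))"
    by (intro add_nonneg_nonneg mult_nn zw w(1))
  ultimately have "- F w \<le> z - w" by (metis le_add_same_cancel1)
  then have "picard w \<le> z" by (simp add: F_def picard_def algebra_simps)
  then show "picard w \<le> w'" using w'z by simp

  define e where "e = infnorm (s - w)"
  have e: "0 \<le> e" by (simp add: e_def infnorm_pos_le)
  have pos: "0 < 1 - 4 * m" using m_small by simp
  have bilin: "infnorm (a * (M *v b)) \<le> m * infnorm a * infnorm b" for a b
    using order_trans[OF infnorm_times_le mult_left_mono[OF infnorm_matrix_vec infnorm_pos_le]]
    by (simp add: mult_ac)
  have szw: "infnorm (s - z) \<le> e" unfolding e_def using zw sz by (intro infnorm_mono_cart) auto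
  have zwe: "infnorm (z - w) \<le> e" unfolding e_def using zw sz by (intro infnorm_mono_cart) auto
  have "(1 - 4 * m) * infnorm (s - z) \<le> m * e * e"
    using D_infnorm_ge[OF w2, of "s - z"] bilin[of "s - w" "s - w"] by (simp add: Dsz e_def)
  then have h: "infnorm (s - z) \<le> m * e * e / (1 - 4 * m)"
    using pos by (simp add: field_simps)
  have "infnorm (D w (s - w')) \<le> m * infnorm (s - z) * infnorm (z - w)
      + m * infnorm (z - w) * infnorm (s - z) + m * infnorm (s - z) * infnorm (s - z)"
    unfolding Dsw' by (intro order_trans[OF infnorm_triangle] add_mono bilin)
  \<comment> \<open>Each product keeps one factor \<open>infnorm (s - z)\<close>, which is of order
    \<open>e\<^sup>2\<close> by \<open>h\<close>; the other factor is at most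
    \<open>e\<close>.\<close>
  also have "\<dots> \<le> m * infnorm (s - z) * e + m * e * infnorm (s - z) + m * infnorm (s - z) * e"
    using m_nonneg szw zwe e infnorm_pos_le[of "s - z"] infnorm_pos_le[of "z - w"]
    by (intro add_mono mult_mono mult_nonneg_nonneg) auto
  also have "\<dots> = 3 * m * e * infnorm (s - z)" by simp
  also have "\<dots> \<le> 3 * m * e * (m * e * e / (1 - 4 * m))"
    using h m_nonneg e by (intro mult_left_mono) auto
  finally have "(1 - 4 * m) * infnorm (s - w') \<le> 3 * m * e * (m * e * e / (1 - 4 * m))"
    using D_infnorm_ge[OF w2, of "s - w'"] by simp
  then have "infnorm (s - w') \<le> 3 * m * e * (m * e * e / (1 - 4 * m)) / (1 - 4 * m)"
    by (subst pos_le_divide_eq[OF pos]) (simp only: mult.commute)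
  also have "\<dots> = 3 * m\<^sup>2 / (1 - 4 * m)\<^sup>2 * e ^ 3"
    by (simp add: power2_eq_square power3_eq_cube)
  finally show "infnorm (w' - s) \<le> 3 * m\<^sup>2 / (1 - 4 * m)\<^sup>2 * infnorm (w - s) ^ 3"
    by (simp add: e_def infnorm_sub)
qed

text \<open>The iterates are squeezed between the Picard iterates and their limit. The condition
  \<open>r \<le> 2\<close> keeps them in the box where the Jacobian is invertible.\<close>

lemma two_step_newton_convergence:
  assumes r: "0 \<le> r" "r \<le> 2" "1 + m * r\<^sup>2 \<le> r"
  shows "two_step_newton_well_defined F"
    and "\<exists>s. minimal_positive_solution F s \<and> converges_Q_cubically (two_step_newton F) s \<and> infnorm s \<le> r"
proof -
  obtain s where lim: "(\<lambda>k. (picard ^^ k) 0) \<longlonglongrightarrow> s"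
    and min: "minimal_positive_solution F s" and s: "infnorm s \<le> r"
    using minimal_solution_picard[OF r(1,3)] .
  let ?w = "two_step_newton F"
  have s0: "F s = 0" "0 \<le> s"
    using min by (auto simp: minimal_positive_solution_def positive_solution_def less_eq_vec_def less_imp_le)
  have s2: "infnorm s \<le> 2" using s r by simp
  have "picard s \<le> s" using s0 by (simp add: F_def picard_def algebra_simps)
  note x = picard_iterates[OF s0(2) this]
  have Suc_w: "?w (Suc k) = newton_step F (?w k) (newton_step F (?w k) (?w k))" for k
    by (simp add: Let_def)
  have inv: "0 \<le> ?w k \<and> ?w k \<le> s \<and> F (?w k) \<le> 0 \<and> (picard ^^ k) 0 \<le> ?w k" for k
  proof (induction k)
    case 0
    then show ?case using s0 by (simp add: F_def less_eq_vec_def)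
  next
    case (Suc k)
    then show ?case
      using two_step_newton_step(1-4)[OF s0(1) s2, of "?w k"] picard_mono[OF x(1), of k "?w k"]
      unfolding Suc_w by (auto intro: order_trans)
  qed
  have w2: "infnorm (?w k) \<le> 2" for k
    using inv[of k] infnorm_mono_cart[of "?w k" s] s2 by linarith
  show "two_step_newton_well_defined F"
    unfolding two_step_newton_well_defined_def
    using F_differentiable jacobian_invertible w2 by blast
  have "(\<lambda>k. ?w k $ i) \<longlonglongrightarrow> s $ i" for i
  proof (rule tendsto_sandwich)
    have "(picard ^^ k) 0 $ i \<le> ?w k $ i \<and> ?w k $ i \<le> s $ i" for k
      using inv[of k] unfolding less_eq_vec_def by blast
    then show "\<forall>\<^sub>F k in sequentially. (picard ^^ k) 0 $ i \<le> ?w k $ i"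
      "\<forall>\<^sub>F k in sequentially. ?w k $ i \<le> s $ i" by (auto intro!: always_eventually)
  qed (rule tendsto_vec_nth[OF lim] tendsto_const)+
  then have "?w \<longlonglongrightarrow> s" by (rule vec_tendstoI)
  moreover have "infnorm (?w (Suc k) - s) \<le> 3 * m\<^sup>2 / (1 - 4 * m)\<^sup>2 * infnorm (?w k - s) ^ 3" for k
    using two_step_newton_step(5)[OF s0(1) s2, of "?w k"] inv[of k] unfolding Suc_w by blast
  ultimately have "converges_Q_cubically ?w s"
    unfolding converges_Q_cubically_def
    by (intro conjI exI[of _ "3 * m\<^sup>2 / (1 - 4 * m)\<^sup>2"]) auto
  then show "\<exists>s. minimal_positive_solution F s \<and> converges_Q_cubically ?w s \<and> infnorm s \<le> r"
    using min s by blast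
qed

end


section \<open>The Riccati map\<close>

definition coupling_matrix :: "real ^ 'n \<Rightarrow> real ^ 'n \<Rightarrow> real \<Rightarrow> real \<Rightarrow> real ^ ('n + 'n) ^ ('n + 'n)" where
  "coupling_matrix \<omega> wt c \<alpha> = (\<chi> k l. case (k, l) of
      (Inl i, Inr j) \<Rightarrow> P_mat \<omega> wt c \<alpha> $ i $ j
    | (Inr i, Inl j) \<Rightarrow> Pt_mat \<omega> wt c \<alpha> $ i $ j
    | _ \<Rightarrow> 0)"

lemma sum_UNIV_Plus: "(\<Sum>k\<in>UNIV. f k) = (\<Sum>i\<in>UNIV. f (Inl i)) + (\<Sum>i\<in>UNIV. f (Inr i))"
  for f :: "'a::finite + 'b::finite \<Rightarrow> 'c::comm_monoid_add"
  by (simp add: UNIV_Plus_UNIV[symmetric] sum.Plus del: UNIV_Plus_UNIV)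

lemma coupling_matrix_mult:
  "coupling_matrix \<omega> wt c \<alpha> *v w = stack (P_mat \<omega> wt c \<alpha> *v lower w) (Pt_mat \<omega> wt c \<alpha> *v upper w)"
  by (auto simp: vec_eq_iff coupling_matrix_def stack_def upper_def lower_def
      matrix_vector_mult_def sum_UNIV_Plus split: sum.split)

text \<open>With nodes \<open>x\<close>, \<open>y\<close> and \<open>a\<close>, \<open>b\<close> the
  factors \<open>1 + \<alpha>\<close>, \<open>1 - \<alpha>\<close> in either order, the last ratio
  lies strictly between 0 and 1.\<close>

lemma kernel_entry:
  fixes x y a b q :: real
  assumes "0 < x" "0 < y" "0 < a" "0 < b" "0 < c"
  shows "(q / (2 * y)) / (1 / (c * x * a) + 1 / (c * y * b)) = q * (c * b / 2) * (x * a / (x * a + y * b))"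
proof -
  have "x * a + y * b > 0" using assms by (simp add: add_pos_pos)
  then show ?thesis using assms by (simp add: divide_simps)
qed

context
  fixes \<omega> wt :: "real ^ 'n::{finite,linorder}" and c \<alpha> :: real
  assumes gl: "gauss_legendre \<omega> wt"
    and c: "0 < c" and \<alpha>: "0 \<le> \<alpha>" "\<alpha> < 1"
begin

lemma P_mat_entry: "P_mat \<omega> wt c \<alpha> $ i $ j
    = wt $ j * (c * (1 - \<alpha>) / 2) * (\<omega> $ i * (1 + \<alpha>) / (\<omega> $ i * (1 + \<alpha>) + \<omega> $ j * (1 - \<alpha>)))"
  using kernel_entry[of "\<omega> $ i" "\<omega> $ j" "1 + \<alpha>" "1 - \<alpha>" c "wt $ j"] gauss_nodes_pos[OF gl] c \<alpha>
  by (simp add: P_mat_def qvec_def delta_def gamma_def)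

lemma Pt_mat_entry: "Pt_mat \<omega> wt c \<alpha> $ i $ j
    = wt $ j * (c * (1 + \<alpha>) / 2) * (\<omega> $ i * (1 - \<alpha>) / (\<omega> $ i * (1 - \<alpha>) + \<omega> $ j * (1 + \<alpha>)))"
  using kernel_entry[of "\<omega> $ i" "\<omega> $ j" "1 - \<alpha>" "1 + \<alpha>" c "wt $ j"] gauss_nodes_pos[OF gl] c \<alpha>
  by (simp add: Pt_mat_def qvec_def delta_def gamma_def)

text \<open>The slack \<open>s \<le> t\<close> lets both blocks share the bound with
  \<open>1 + \<alpha>\<close>, although the scalar in \<open>P_mat\<close> carries
  \<open>1 - \<alpha>\<close>.\<close>

lemma weighted_entry_bounds:
  assumes "0 < a" "0 < b" "0 < s" "s \<le> t"
  shows "0 < wt $ j * s * (\<omega> $ i * a / (\<omega> $ i * a + \<omega> $ j * b))"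
    and "wt $ j * s * (\<omega> $ i * a / (\<omega> $ i * a + \<omega> $ j * b)) < wt $ j * t"
proof -
  note pos = gauss_nodes_pos[OF gl] gauss_weights_pos[OF gl]
  let ?r = "\<omega> $ i * a / (\<omega> $ i * a + \<omega> $ j * b)"
  have "0 < \<omega> $ i * a" "0 < \<omega> $ j * b" using assms pos by simp_all
  then have r: "0 < ?r" "?r < 1" by (simp_all add: add_pos_pos)
  show "0 < wt $ j * s * ?r" by (intro mult_pos_pos pos assms r)
  have "wt $ j * s * ?r < wt $ j * s * 1" using r assms pos by (intro mult_strict_left_mono) auto
  also have "\<dots> \<le> wt $ j * t" using assms(4) pos[of j] by (simp add: mult_left_mono less_imp_le)
  finally show "wt $ j * s * ?r < wt $ j * t" .
qed

lemma P_mat_bounds: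
  "0 < P_mat \<omega> wt c \<alpha> $ i $ j" "P_mat \<omega> wt c \<alpha> $ i $ j < wt $ j * (c * (1 + \<alpha>) / 2)"
  unfolding P_mat_entry
  by (rule weighted_entry_bounds(1)[OF _ _ _ order_refl] weighted_entry_bounds(2); use c \<alpha> in simp)+

lemma Pt_mat_bounds:
  "0 < Pt_mat \<omega> wt c \<alpha> $ i $ j" "Pt_mat \<omega> wt c \<alpha> $ i $ j < wt $ j * (c * (1 + \<alpha>) / 2)"
  unfolding Pt_mat_entry
  by (rule weighted_entry_bounds(1)[OF _ _ _ order_refl] weighted_entry_bounds(2); use c \<alpha> in simp)+

lemma coupling_matrix_nonneg: "0 \<le> coupling_matrix \<omega> wt c \<alpha> $ k $ l"
  using P_mat_bounds(1) Pt_mat_bounds(1)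
  by (auto simp: coupling_matrix_def less_imp_le split: sum.split)

text \<open>Each row meets one nonzero block, and the weights sum to 1. Strictness comes from the
  individual entries.\<close>

lemma coupling_matrix_row_sum: "(\<Sum>l\<in>UNIV. coupling_matrix \<omega> wt c \<alpha> $ k $ l) < c * (1 + \<alpha>) / 2"
proof -
  have *: "(\<Sum>j\<in>UNIV. g j) < c * (1 + \<alpha>) / 2" if "\<And>j. g j < wt $ j * (c * (1 + \<alpha>) / 2)" for g
  proof -
    have "(\<Sum>j\<in>UNIV. g j) < (\<Sum>j\<in>UNIV. wt $ j * (c * (1 + \<alpha>) / 2))"
      using that by (intro sum_strict_mono) auto
    also have "\<dots> = c * (1 + \<alpha>) / 2"
      unfolding sum_distrib_right[symmetric] gauss_weights_sum[OF gl] by simp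
    finally show ?thesis .
  qed
  show ?thesis
    using *[OF P_mat_bounds(2)] *[OF Pt_mat_bounds(2)]
    by (cases k) (simp_all add: sum_UNIV_Plus coupling_matrix_def)
qed

end

section \<open>The scalar majorant and assembly of the theorem\<close>

lemma smaller_root:
  fixes \<kappa> :: real
  assumes "0 < \<kappa>" "\<kappa> \<le> 1 / 2"
  defines "r \<equiv> (1 - sqrt (1 - 2 * \<kappa>)) / \<kappa>"
  shows "0 \<le> r" "r \<le> 2" "1 + \<kappa> / 2 * r\<^sup>2 = r"
proof -
  define t where "t = sqrt (1 - 2 * \<kappa>)"
  have t: "0 \<le> t" "t\<^sup>2 = 1 - 2 * \<kappa>" using assms by (simp_all add: t_def)
  have "t \<le> 1" using assms by (simp add: t_def)
  then show "0 \<le> r" using assms by (simp add: r_def t_def)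
  \<comment> \<open>This factorization cancels \<open>1 - t\<close> and gives the rationalized root
    \<open>2 / (1 + t)\<close>.\<close>
  have \<kappa>: "\<kappa> = (1 - t) * (1 + t) / 2" using t by (simp add: algebra_simps power2_eq_square)
  then have "t \<noteq> 1" using assms by auto
  then have r: "r = 2 / (1 + t)"
    unfolding r_def t_def[symmetric] unfolding \<kappa> using t by (simp add: divide_simps)
  show "r \<le> 2" using t by (simp add: r divide_simps)
  show "1 + \<kappa> / 2 * r\<^sup>2 = r"
    unfolding r \<kappa> using t(1) by (simp add: divide_simps power2_eq_square)
qed

theorem mainTheorem6:
  fixes \<omega> wt :: "real ^ 'n::{finite,linorder}" and c \<alpha> :: real
  assumes "gauss_legendre \<omega> wt"
    and "0 < c" and "c \<le> 1"
    and "0 \<le> \<alpha>" and "\<alpha> < 1"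
    and "c * (1 + \<alpha>) \<le> 1 / 2"
  shows "two_step_newton_well_defined (riccati_map \<omega> wt c \<alpha>) \<and>
    (\<exists>wstar. minimal_positive_solution (riccati_map \<omega> wt c \<alpha>) wstar \<and>
       converges_Q_superquadratically (two_step_newton (riccati_map \<omega> wt c \<alpha>)) wstar \<and>
       (c * (1 + \<alpha>) < 4 / 9 \<longrightarrow>
          converges_Q_cubically (two_step_newton (riccati_map \<omega> wt c \<alpha>)) wstar) \<and>
       (\<forall>r. (1 - sqrt (1 - 2 * (c * (1 + \<alpha>)))) / (c * (1 + \<alpha>)) \<le> r \<and>
            r < (1 + sqrt (1 - 2 * (c * (1 + \<alpha>)))) / (c * (1 + \<alpha>)) \<longrightarrow>
            0 < infnorm wstar \<and> infnorm wstar \<le> r))"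
proof -
  let ?\<kappa> = "c * (1 + \<alpha>)" and ?f = "riccati_map \<omega> wt c \<alpha>"
  define M where "M = coupling_matrix \<omega> wt c \<alpha>"
  \<comment> \<open>The largest actual row sum replaces \<open>?\<kappa> / 2\<close>: a maximum over
    finitely many rows stays strictly below it, so \<open>m < 1 / 4\<close> even at
    \<open>?\<kappa> = 1 / 2\<close>.\<close>
  define m where "m = Max (range (\<lambda>k. \<Sum>l\<in>UNIV. M $ k $ l))"
  have "m < ?\<kappa> / 2"
    unfolding m_def M_def
    by (subst Max_less_iff) (use coupling_matrix_row_sum[OF assms(1,2,4,5)] in auto)
  interpret small_nonneg_matrix M m
  proof
    show "0 \<le> M $ i $ j" for i j
      unfolding M_def by (rule coupling_matrix_nonneg[OF assms(1,2,4,5)])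
    show "(\<Sum>j\<in>UNIV. M $ i $ j) \<le> m" for i by (simp add: m_def)
    show "m < 1 / 4" using \<open>m < ?\<kappa> / 2\<close> assms(6) by simp
  qed
  have F: "F = ?f"
    by (rule ext) (simp add: F_def riccati_map_def coupling_matrix_mult[of \<omega> wt c \<alpha>, folded M_def])
  \<comment> \<open>The left end of the admissible interval; the bound at this \<open>r\<close>
    passes to every larger one.\<close>
  define r where "r = (1 - sqrt (1 - 2 * ?\<kappa>)) / ?\<kappa>"
  have "0 < ?\<kappa>" using assms by simp
  note root = smaller_root[OF this assms(6), folded r_def]
  have "m * r\<^sup>2 \<le> ?\<kappa> / 2 * r\<^sup>2" using \<open>m < ?\<kappa> / 2\<close> by (intro mult_right_mono) auto
  then have "1 + m * r\<^sup>2 \<le> r" using root(3) by linarith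
  note newton = two_step_newton_convergence[OF root(1,2) this, unfolded F]
  then obtain s where s: "minimal_positive_solution ?f s"
    "converges_Q_cubically (two_step_newton ?f) s" "infnorm s \<le> r" by blast
  have "s \<noteq> 0"
    using s(1) by (auto simp: minimal_positive_solution_def positive_solution_def)
  then have "0 < infnorm s" by (simp add: infnorm_pos_lt)
  then show ?thesis
    using newton(1) s cubic_imp_superquadratic[OF s(2)] unfolding r_def by (intro conjI exI[of _ s]) auto
qed

end
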